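(* Let $z, w \in \mathbb{C}$ with $|z| = |w| = 1$. The irreducible unitary representations $\pi^z$ and $\pi^w$ of $\mathbb{Z}$ on $\mathbb{C}$ are additive conjugates if and only if for every polynomial $p(x) \in \mathbb{Z}[x]$ it holds that $p(z) = 0$ if and only if $p(w) = 0$.
   Context: For $z \in \mathbb{C}$ with $|z| = 1$, $\pi^z$ denotes the one-dimensional unitary representation of $\mathbb{Z}$ on $\mathbb{C}$ given by $\pi^z_n x = z^n x$ for $n \in \mathbb{Z}$, $x \in \mathbb{C}$. Two representations $\pi$ on $\mathcal{H}$ and $\pi'$ on $\mathcal{H}'$ of a group $G$ are additive conjugates if there exists a bijection $\xi \colon \mathcal{H} \to \mathcal{H}'$, not necessarily continuous or linear, such that $\xi(v+w) = \xi(v)+\xi(w)$ and $\xi(\pi_g v) = \pi'_g \xi(v)$ for all $v,w \in \mathcal{H}$ and $g \in G$. *)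

theory Defs
  imports "HOL-Analysis.Analysis" "HOL-Algebra.Elementary_Groups"
begin

text \<open>
  The distribution has no complex inner product spaces. A complex Hilbert space is therefore given by
  a complex scalar multiplication and a sesquilinear form on a Banach space that are compatible with
  the real scalar multiplication and the norm; completeness comes from the class \<^class>\<open>banach\<close>.
\<close>

locale complex_hilbert_space = vector_space scale
  for scale :: "complex \<Rightarrow> 'h::banach \<Rightarrow> 'h" +
  fixes ip :: "'h \<Rightarrow> 'h \<Rightarrow> complex"
  assumes scale_of_real: "scale (of_real r) x = r *\<^sub>R x"
    and ip_add_left: "ip (x + y) v = ip x v + ip y v"
    and ip_scale_left: "ip (scale c x) v = c * ip x v"
    and ip_commute: "ip x y = cnj (ip y x)"
    and ip_norm: "ip x x = of_real ((norm x)\<^sup>2)"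

text \<open>
  Groups are regarded as discrete, so there is no continuity condition on the map from the group
  to the unitary operators.
\<close>

locale unitary_rep = group G + complex_hilbert_space scale ip
  for G :: "('g, 'b) monoid_scheme" (structure)
    and scale :: "complex \<Rightarrow> 'h::banach \<Rightarrow> 'h"
    and ip :: "'h \<Rightarrow> 'h \<Rightarrow> complex" +
  fixes \<pi> :: "'g \<Rightarrow> 'h \<Rightarrow> 'h"
  assumes rep_linear: "g \<in> carrier G \<Longrightarrow> Vector_Spaces.linear scale scale (\<pi> g)"
    and rep_surj: "g \<in> carrier G \<Longrightarrow> surj (\<pi> g)"
    and rep_isometric: "g \<in> carrier G \<Longrightarrow> ip (\<pi> g x) (\<pi> g y) = ip x y"
    and rep_mult: "\<lbrakk>g \<in> carrier G; h \<in> carrier G\<rbrakk> \<Longrightarrow> \<pi> (g \<otimes> h) x = \<pi> g (\<pi> h x)"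

locale irreducible_unitary_rep = unitary_rep G scale ip \<pi>
  for G :: "('g, 'b) monoid_scheme" (structure)
    and scale :: "complex \<Rightarrow> 'h::banach \<Rightarrow> 'h"
    and ip :: "'h \<Rightarrow> 'h \<Rightarrow> complex"
    and \<pi> :: "'g \<Rightarrow> 'h \<Rightarrow> 'h" +
  assumes nontrivial: "\<exists>v::'h. v \<noteq> 0"
    and irreducible: "\<lbrakk>module.subspace scale V; closed V; \<And>g. g \<in> carrier G \<Longrightarrow> \<pi> g ` V \<subseteq> V\<rbrakk>
      \<Longrightarrow> V = {0} \<or> V = UNIV"

definition additive_conjugate ::
  "('g, 'b) monoid_scheme \<Rightarrow> ('g \<Rightarrow> 'h::ab_group_add \<Rightarrow> 'h) \<Rightarrow>
    ('g \<Rightarrow> 'k::ab_group_add \<Rightarrow> 'k) \<Rightarrow> bool"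
  where "additive_conjugate G \<pi> \<pi>' \<longleftrightarrow>
    (\<exists>\<xi>. bij \<xi> \<and> (\<forall>v w. \<xi> (v + w) = \<xi> v + \<xi> w) \<and>
      (\<forall>g\<in>carrier G. \<forall>v. \<xi> (\<pi> g v) = \<pi>' g (\<xi> v)))"

definition int_rep :: "complex \<Rightarrow> int \<Rightarrow> complex \<Rightarrow> complex"
  where "int_rep z n x = z powi n * x"

lemma irreducible_unitary_rep_int_rep:
  assumes "norm z = 1"
  shows "irreducible_unitary_rep integer_group (*) (\<lambda>x y. x * cnj y) (int_rep z)"
proof -
  interpret complex_hilbert_space "(*)" "\<lambda>x y. x * cnj y"
    by unfold_locales
      (auto simp: algebra_simps scaleR_conv_of_real simp flip: complex_norm_square of_real_power)
  have z: "z \<noteq> 0" using assms by auto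
  have n: "norm (z powi n) = 1" for n using assms by (simp add: norm_power_int)
  interpret unitary_rep integer_group "(*)" "\<lambda>x y. x * cnj y" "int_rep z"
  proof (rule unitary_rep.intro[OF _ _ unitary_rep_axioms.intro])
    fix g :: int and x y :: complex
    show "Vector_Spaces.linear (*) (*) (int_rep z g)"
      by unfold_locales (auto simp: int_rep_def algebra_simps)
    have "int_rep z g (u / z powi g) = u" for u
      using z by (simp add: int_rep_def)
    then show "surj (int_rep z g)" by (rule surjI)
    have "z powi g * cnj (z powi g) = 1"
      using n[of g] by (metis complex_norm_square of_real_1 power_one)
    then show "int_rep z g x * cnj (int_rep z g y) = x * cnj y"
      unfolding int_rep_def complex_cnj_mult by (metis mult.assoc mult.left_commute mult_1)
  qed (use z in \<open>auto simp: int_rep_def power_int_add complex_hilbert_space_axioms\<close>)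
  show ?thesis
  proof unfold_locales
    show "\<exists>v::complex. v \<noteq> 0" by (rule exI[of _ 1]) simp
    fix V :: "complex set"
    assume V: "module.subspace (*) V"
    have "V = UNIV" if "v \<in> V" "v \<noteq> 0" for v
    proof -
      have "(u / v) * v \<in> V" for u using vector_space_over_itself.subspace_scale[OF V that(1)] .
      then show ?thesis using that(2) by auto
    qed
    then show "V = {0} \<or> V = UNIV" using vector_space_over_itself.subspace_0[OF V] by blast
  qed
qed

end

theory Submission
  imports Defs "HOL-Library.Equipollence" "HOL-Library.Groups_Big_Fun"
begin

text \<open>
  An additive conjugation \<open>\<xi>\<close> satisfies \<open>\<xi> (p(z) x) = p(w) \<xi> x\<close> for every integer polynomial \<open>p\<close>,
  so \<open>z\<close> and \<open>w\<close> are roots of the same integer polynomials. Conversely, if they are, then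
  \<open>p(z)/q(z) \<mapsto> p(w)/q(w)\<close> is an isomorphism \<open>\<sigma>\<close> from \<open>\<rat>(z)\<close> onto \<open>\<rat>(w)\<close>. Both fields are countable,
  so the complex numbers have a basis of cardinality of the continuum over either of them, and a
  bijection of such bases extends to a \<open>\<sigma>\<close>-semilinear bijection.
\<close>

section \<open>Bases of a field over a subfield\<close>

locale field_subset =
  fixes K :: "'a::field set"
  assumes one: "1 \<in> K"
    and diff: "\<lbrakk>x \<in> K; y \<in> K\<rbrakk> \<Longrightarrow> x - y \<in> K"
    and mult: "\<lbrakk>x \<in> K; y \<in> K\<rbrakk> \<Longrightarrow> x * y \<in> K"
    and inverse: "x \<in> K \<Longrightarrow> inverse x \<in> K"
begin

lemma zero: "0 \<in> K"
  using diff[OF one one] by simp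

lemma uminus: "x \<in> K \<Longrightarrow> - x \<in> K"
  using diff[OF zero] by fastforce

lemma add: "\<lbrakk>x \<in> K; y \<in> K\<rbrakk> \<Longrightarrow> x + y \<in> K"
  using diff[of x "- y"] uminus by simp

end

definition coeff_funs :: "'a::field set \<Rightarrow> 'a set \<Rightarrow> ('a \<Rightarrow> 'a) set"
  where "coeff_funs K B = {c. finite {b. c b \<noteq> 0} \<and> {b. c b \<noteq> 0} \<subseteq> B \<and> range c \<subseteq> K}"

definition lincomb :: "('a::field \<Rightarrow> 'a) \<Rightarrow> 'a"
  where "lincomb c = Sum_any (\<lambda>b. c b * b)"

definition independent_over :: "'a::field set \<Rightarrow> 'a set \<Rightarrow> bool"
  where "independent_over K B \<longleftrightarrow> (\<forall>c \<in> coeff_funs K B. lincomb c = 0 \<longrightarrow> c = (\<lambda>_. 0))"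

definition basis_over :: "'a::field set \<Rightarrow> 'a set \<Rightarrow> bool"
  where "basis_over K B \<longleftrightarrow> bij_betw lincomb (coeff_funs K B) UNIV"

lemma finite_supp_mult:
  fixes c :: "'a \<Rightarrow> 'b::mult_zero"
  assumes "finite {b. c b \<noteq> 0}"
  shows "finite {b. c b * g b \<noteq> 0}"
  by (rule finite_subset[OF _ assms]) auto

lemma lincomb_add:
  assumes "finite {b. c b \<noteq> 0}" "finite {b. d b \<noteq> 0}"
  shows "lincomb (\<lambda>b. c b + d b) = lincomb c + lincomb d"
  unfolding lincomb_def distrib_right
  by (rule Sum_any.distrib) (intro finite_supp_mult assms)+

lemma lincomb_scale:
  assumes "finite {b. c b \<noteq> 0}"
  shows "lincomb (\<lambda>b. k * c b) = k * lincomb c"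
  unfolding lincomb_def
  by (subst Sum_any_right_distrib) (auto intro!: finite_supp_mult assms simp: mult.assoc)

lemma lincomb_single: "lincomb (\<lambda>b. if b = a then k else 0) = k * a"
proof -
  have "(\<lambda>b. (if b = a then k else 0) * b) = (\<lambda>b. if b = a then k * b else 0)"
    by auto
  then have "lincomb (\<lambda>b. if b = a then k else 0) = Sum_any (\<lambda>b. if b = a then k * b else 0)"
    unfolding lincomb_def by (rule arg_cong)
  also have "\<dots> = k * a" by (rule Sum_any.delta)
  finally show ?thesis .
qed

context field_subset
begin

lemma coeff_funs_add:
  assumes "c \<in> coeff_funs K B" "d \<in> coeff_funs K B"
  shows "(\<lambda>b. c b + d b) \<in> coeff_funs K B"
proof -
  have supp: "{b. c b + d b \<noteq> 0} \<subseteq> {b. c b \<noteq> 0} \<union> {b. d b \<noteq> 0}" by auto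
  have "finite {b. c b + d b \<noteq> 0}"
    by (rule finite_subset[OF supp]) (use assms in \<open>simp add: coeff_funs_def\<close>)
  moreover have "{b. c b + d b \<noteq> 0} \<subseteq> B"
    by (rule order_trans[OF supp]) (use assms in \<open>simp add: coeff_funs_def\<close>)
  ultimately show ?thesis using assms by (auto simp: coeff_funs_def intro!: add)
qed

lemma coeff_funs_scale:
  assumes "k \<in> K" "c \<in> coeff_funs K B"
  shows "(\<lambda>b. k * c b) \<in> coeff_funs K B"
proof -
  have "finite {b. k * c b \<noteq> 0}"
    by (rule finite_subset[of _ "{b. c b \<noteq> 0}"]) (use assms in \<open>auto simp: coeff_funs_def\<close>)
  then show ?thesis using assms by (auto simp: coeff_funs_def intro!: mult)
qed

lemma coeff_funs_single:
  assumes "a \<in> B" "k \<in> K"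
  shows "(\<lambda>b. if b = a then k else 0) \<in> coeff_funs K B"
  using assms by (auto simp: coeff_funs_def zero)

lemma independent_over_inj:
  assumes "independent_over K B"
  shows "inj_on lincomb (coeff_funs K B)"
proof (rule inj_onI)
  fix c d assume cd: "c \<in> coeff_funs K B" "d \<in> coeff_funs K B" "lincomb c = lincomb d"
  have m: "- 1 \<in> K" using uminus one .
  define e where "e = (\<lambda>b. c b + - 1 * d b)"
  have e: "e \<in> coeff_funs K B"
    unfolding e_def using coeff_funs_add[OF cd(1) coeff_funs_scale[OF m cd(2)]] .
  have "lincomb e = lincomb c + - 1 * lincomb d"
    unfolding e_def
    using cd coeff_funs_scale[OF m cd(2)]
    by (subst lincomb_add, simp_all only: coeff_funs_def mem_Collect_eq lincomb_scale)
  then have "e = (\<lambda>_. 0)" using assms e cd(3) by (simp add: independent_over_def)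
  then show "c = d" by (simp add: e_def fun_eq_iff)
qed

lemma independent_over_insert:
  assumes ind: "independent_over K B" and x: "x \<notin> lincomb ` coeff_funs K B"
  shows "independent_over K (insert x B)"
  unfolding independent_over_def
proof (intro ballI impI)
  fix c assume c: "c \<in> coeff_funs K (insert x B)" and c0: "lincomb c = 0"
  define d where "d = (\<lambda>b. if b = x then 0 else c b)"
  have "finite {b. d b \<noteq> 0}"
    by (rule finite_subset[of _ "{b. c b \<noteq> 0}"]) (use c in \<open>auto simp: coeff_funs_def d_def\<close>)
  then have d: "d \<in> coeff_funs K B"
    using c zero by (auto simp: coeff_funs_def d_def split: if_splits)
  have "c = (\<lambda>b. d b + (if b = x then c x else 0))" by (auto simp: d_def)
  then have "lincomb c = lincomb d + c x * x"
    using lincomb_add[of d "\<lambda>b. if b = x then c x else 0"] d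
    by (simp add: lincomb_single coeff_funs_def)
  then have eq: "lincomb d + c x * x = 0" using c0 by simp
  have "c x = 0"
  proof (rule ccontr)
    assume nz: "c x \<noteq> 0"
    have k: "- inverse (c x) \<in> K"
      using c by (intro uminus inverse) (auto simp: coeff_funs_def)
    have "lincomb (\<lambda>b. - inverse (c x) * d b) = - inverse (c x) * lincomb d"
      by (rule lincomb_scale) (use d in \<open>simp add: coeff_funs_def\<close>)
    also have "lincomb d = - (c x * x)" using eq by (simp add: eq_neg_iff_add_eq_0)
    also have "- inverse (c x) * - (c x * x) = x" using nz by simp
    finally show False using x coeff_funs_scale[OF k d] by (metis image_eqI)
  qed
  moreover from this have "d = (\<lambda>_. 0)"
    using eq ind d by (simp add: independent_over_def)
  ultimately show "c = (\<lambda>_. 0)" unfolding d_def fun_eq_iff by metis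
qed

lemma basis_over_exists: "\<exists>B. basis_over K B"
proof -
  have "\<exists>M\<in>Collect (independent_over K). \<forall>X\<in>Collect (independent_over K). M \<subseteq> X \<longrightarrow> X = M"
  proof (rule subset_Zorn_nonempty)
    have "independent_over K {}" by (auto simp: independent_over_def coeff_funs_def)
    then show "Collect (independent_over K) \<noteq> {}" by blast
    fix \<C> assume ne: "\<C> \<noteq> {}" and ch: "subset.chain (Collect (independent_over K)) \<C>"
    have "c = (\<lambda>_. 0)" if c: "c \<in> coeff_funs K (\<Union>\<C>)" "lincomb c = 0" for c
    proof -
      obtain B where B: "B \<in> \<C>" "{b. c b \<noteq> 0} \<subseteq> B"
        using finite_subset_Union_chain[of "{b. c b \<noteq> 0}" \<C>, OF _ _ ne ch] c
        by (auto simp: coeff_funs_def)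
      then have "independent_over K B" using ch by (auto simp: subset_chain_def)
      moreover have "c \<in> coeff_funs K B" using c B by (simp add: coeff_funs_def)
      ultimately show ?thesis using c by (simp add: independent_over_def)
    qed
    then show "\<Union>\<C> \<in> Collect (independent_over K)" by (simp add: independent_over_def)
  qed
  then obtain B where ind: "independent_over K B"
    and max: "\<And>X. independent_over K X \<Longrightarrow> B \<subseteq> X \<Longrightarrow> X = B"
    by auto
  have "x \<in> lincomb ` coeff_funs K B" for x
  proof (rule ccontr)
    assume x: "x \<notin> lincomb ` coeff_funs K B"
    then have "x \<in> B"
      using max[OF independent_over_insert[OF ind x]] by blast
    then have "lincomb (\<lambda>b. if b = x then 1 else 0) \<in> lincomb ` coeff_funs K B"
      by (intro imageI coeff_funs_single one)
    then show False using x by (simp add: lincomb_single)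
  qed
  then show ?thesis
    using independent_over_inj[OF ind] by (auto simp: basis_over_def bij_betw_def)
qed

end

lemma infinite_times_lepoll:
  assumes "infinite C" "A \<lesssim> C" "B \<lesssim> C"
  shows "A \<times> B \<lesssim> C"
proof -
  have "C \<times> C \<approx> C"
    unfolding eqpoll_iff_card_of_ordIso using assms(1) by (rule card_of_Times_same_infinite)
  then show ?thesis using times_lepoll_mono[OF assms(2,3)] by (rule lepoll_trans2[rotated])
qed

lemma lists_lepoll_infinite:
  assumes "infinite A"
  shows "lists A \<lesssim> A"
proof -
  have len: "{xs \<in> lists A. length xs = n} \<lesssim> A" for n
  proof (induction n)
    case 0
    have "{xs \<in> lists A. length xs = 0} = {[]}" by auto
    then show ?case using assms by (simp add: finite_lepoll_infinite)
  next
    case (Suc n)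
    have "{xs \<in> lists A. length xs = Suc n}
        \<subseteq> (\<lambda>(x, xs). x # xs) ` (A \<times> {xs \<in> lists A. length xs = n})"
      by (auto simp: length_Suc_conv)
    then have "{xs \<in> lists A. length xs = Suc n} \<lesssim> A \<times> {xs \<in> lists A. length xs = n}"
      by (rule subset_image_lepoll)
    also have "\<dots> \<lesssim> A" using assms Suc by (intro infinite_times_lepoll) auto
    finally show ?case .
  qed
  then have "\<forall>n. \<exists>f. {xs \<in> lists A. length xs = n} \<subseteq> f ` A" by (simp add: lepoll_iff)
  then obtain f where f: "\<And>n. {xs \<in> lists A. length xs = n} \<subseteq> f n ` A" by metis
  have "lists A \<subseteq> (\<lambda>(n, a). f n a) ` (UNIV \<times> A)" using f by force
  then have "lists A \<lesssim> (UNIV :: nat set) \<times> A" by (rule subset_image_lepoll)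
  also have "\<dots> \<lesssim> A"
    using assms by (intro infinite_times_lepoll) (auto simp: infinite_le_lepoll)
  finally show ?thesis .
qed

lemma basis_over_eqpoll_UNIV:
  fixes B :: "'a::field set"
  assumes basis: "basis_over K B" and K: "countable K" and unc: "uncountable (UNIV :: 'a set)"
  shows "B \<approx> (UNIV :: 'a set)"
proof (rule lepoll_antisym)
  show "B \<lesssim> (UNIV :: 'a set)" by (rule subset_imp_lepoll) simp
  have "x \<in> (\<lambda>xs. \<Sum>(k, b)\<leftarrow>xs. k * b) ` lists (K \<times> B)" for x
  proof -
    have "x \<in> lincomb ` coeff_funs K B" using basis by (simp add: basis_over_def bij_betw_def)
    then obtain c where c: "c \<in> coeff_funs K B" "x = lincomb c" by blast
    then obtain bs where bs: "set bs = {b. c b \<noteq> 0}" "distinct bs"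
      using finite_distinct_list[of "{b. c b \<noteq> 0}"] by (auto simp: coeff_funs_def)
    have "x = (\<Sum>b\<in>set bs. c b * b)"
      unfolding c lincomb_def by (rule Sum_any.expand_superset[OF finite_set]) (auto simp: bs(1))
    also have "\<dots> = (\<Sum>(k, b)\<leftarrow>map (\<lambda>b. (c b, b)) bs. k * b)"
      using bs(2) by (simp add: sum.distinct_set_conv_list o_def)
    finally show ?thesis
      by (rule image_eqI) (use c(1) bs range_subsetD[of c K] in \<open>auto simp: coeff_funs_def\<close>)
  qed
  then have UNIV: "(UNIV :: 'a set) \<lesssim> lists (K \<times> B)"
    by (intro subset_image_lepoll) blast
  have "uncountable B"
  proof
    assume "countable B"
    then have "countable (lists (K \<times> B))" using K by (intro countable_lists) auto
    then show False using UNIV unc countable_lepoll by blast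
  qed
  then have inf: "infinite B" by (meson countable_finite)
  have "K \<lesssim> (UNIV :: nat set)" using K by (simp add: countable_def lepoll_def')
  also have "\<dots> \<lesssim> B" using inf by (simp add: infinite_le_lepoll)
  finally have KB: "K \<times> B \<lesssim> B" using inf by (intro infinite_times_lepoll) auto
  note UNIV
  also have "lists (K \<times> B) \<lesssim> lists B" using KB by (rule lists_lepoll_mono)
  also have "\<dots> \<lesssim> B" using inf by (rule lists_lepoll_infinite)
  finally show "(UNIV :: 'a set) \<lesssim> B" .
qed

section \<open>Semilinear bijections\<close>

lemma semilinear_bij_exists:
  fixes \<sigma> :: "'a::field \<Rightarrow> 'a"
  assumes K: "field_subset K" and L: "field_subset L" and \<sigma>: "bij_betw \<sigma> K L"
    and \<sigma>_add: "\<And>x y. \<lbrakk>x \<in> K; y \<in> K\<rbrakk> \<Longrightarrow> \<sigma> (x + y) = \<sigma> x + \<sigma> y"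
    and \<sigma>_mult: "\<And>x y. \<lbrakk>x \<in> K; y \<in> K\<rbrakk> \<Longrightarrow> \<sigma> (x * y) = \<sigma> x * \<sigma> y"
    and cK: "countable K" and unc: "uncountable (UNIV :: 'a set)"
  obtains \<xi> where "bij \<xi>" "\<And>x y. \<xi> (x + y) = \<xi> x + \<xi> y"
    "\<And>k x. k \<in> K \<Longrightarrow> \<xi> (k * x) = \<sigma> k * \<xi> x"
proof -
  interpret K: field_subset K by fact
  interpret L: field_subset L by fact
  obtain B where B: "basis_over K B" using K.basis_over_exists by blast
  obtain C where C: "basis_over L C" using L.basis_over_exists by blast
  have "countable L" using cK \<sigma> by (metis bij_betw_imp_surj_on countable_image)
  then have "B \<approx> C"
    using basis_over_eqpoll_UNIV[OF B cK unc] basis_over_eqpoll_UNIV[OF C _ unc]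
      eqpoll_sym eqpoll_trans by blast
  then have "C \<approx> B" by (rule eqpoll_sym)
  then obtain f where f: "bij_betw f C B" by (auto simp: eqpoll_def)
  have \<sigma>0: "\<sigma> 0 = 0" using \<sigma>_add[OF K.zero K.zero] by (metis add_0 add_cancel_right_right)
  have \<sigma>0_iff: "\<sigma> x = 0 \<longleftrightarrow> x = 0" if "x \<in> K" for x
    using that \<sigma>0 K.zero bij_betw_imp_inj_on[OF \<sigma>] by (metis inj_onD)
  define \<Phi> where "\<Phi> c = (\<lambda>b. if b \<in> C then \<sigma> (c (f b)) else 0)" for c
  have bij: "bij_betw \<Phi> (coeff_funs K B) (coeff_funs L C)"
  proof (rule bij_betw_imageI)
    show "inj_on \<Phi> (coeff_funs K B)"
    proof (rule inj_onI, rule ext)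
      fix c d b assume c: "c \<in> coeff_funs K B" and d: "d \<in> coeff_funs K B" and eq: "\<Phi> c = \<Phi> d"
      show "c b = d b"
      proof (cases "b \<in> B")
        case True
        then obtain b' where b': "b' \<in> C" "f b' = b" using f by (metis bij_betw_def imageE)
        then have "\<sigma> (c b) = \<sigma> (d b)" using fun_cong[OF eq, of b'] by (simp add: \<Phi>_def)
        moreover have "c b \<in> K" "d b \<in> K" using c d by (auto simp: coeff_funs_def)
        ultimately show ?thesis using bij_betw_imp_inj_on[OF \<sigma>] by (metis inj_onD)
      next
        case False
        then have "c b = 0" "d b = 0" using c d by (auto simp: coeff_funs_def)
        then show ?thesis by simp
      qed
    qed
    have "\<Phi> c \<in> coeff_funs L C" if c: "c \<in> coeff_funs K B" for c
    proof -
      have cK: "c b \<in> K" for b using c by (auto simp: coeff_funs_def)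
      have "{b. \<Phi> c b \<noteq> 0} \<subseteq> f -` {b. c b \<noteq> 0} \<inter> C" by (auto simp: \<Phi>_def \<sigma>0)
      moreover have "finite (f -` {b. c b \<noteq> 0} \<inter> C)"
        using c f by (intro finite_vimage_IntI) (auto simp: coeff_funs_def bij_betw_def)
      ultimately have "finite {b. \<Phi> c b \<noteq> 0}" by (rule finite_subset)
      moreover have "range (\<Phi> c) \<subseteq> L"
        using bij_betwE[OF \<sigma>] cK L.zero by (auto simp: \<Phi>_def)
      ultimately show ?thesis by (auto simp: coeff_funs_def \<Phi>_def)
    qed
    moreover have "d \<in> \<Phi> ` coeff_funs K B" if d: "d \<in> coeff_funs L C" for d
    proof
      define g where "g = inv_into C f"
      have g: "g b \<in> C" "f (g b) = b" if "b \<in> B" for b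
        using that f by (auto simp: g_def bij_betw_def inv_into_into f_inv_into_f)
      have gf: "g (f b) = b" if "b \<in> C" for b
        using that f by (auto simp: g_def bij_betw_def)
      define c where "c b = (if b \<in> B then inv_into K \<sigma> (d (g b)) else 0)" for b
      have dL: "d b \<in> L" for b using d by (auto simp: coeff_funs_def)
      have s: "inv_into K \<sigma> y \<in> K" "\<sigma> (inv_into K \<sigma> y) = y" if "y \<in> L" for y
        using that \<sigma> by (auto simp: bij_betw_def inv_into_into f_inv_into_f)
      have s0: "inv_into K \<sigma> 0 = 0" using s[OF L.zero] \<sigma>0_iff by blast
      have "{b. c b \<noteq> 0} \<subseteq> f ` {b. d b \<noteq> 0}"
      proof
        fix b assume "b \<in> {b. c b \<noteq> 0}"
        then have "b \<in> B" "d (g b) \<noteq> 0" by (auto simp: c_def s0 split: if_splits)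
        then show "b \<in> f ` {b. d b \<noteq> 0}" by (intro image_eqI[of _ _ "g b"]) (simp_all add: g)
      qed
      then have "finite {b. c b \<noteq> 0}"
        using d by (rule_tac finite_subset) (auto simp: coeff_funs_def)
      then show "c \<in> coeff_funs K B"
        using s dL K.zero by (auto simp: coeff_funs_def c_def)
      show "d = \<Phi> c"
      proof
        fix b show "d b = \<Phi> c b"
        proof (cases "b \<in> C")
          case True
          then show ?thesis
            using f s dL by (simp add: \<Phi>_def c_def gf bij_betwE)
        next
          case False
          then show ?thesis using d by (auto simp: \<Phi>_def coeff_funs_def)
        qed
      qed
    qed
    ultimately show "\<Phi> ` coeff_funs K B = coeff_funs L C" by blast
  qed
  have \<Phi>_mem: "\<Phi> c \<in> coeff_funs L C" if "c \<in> coeff_funs K B" for c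
    using bij that by (rule bij_betw_apply)
  define \<gamma> where "\<gamma> = inv_into (coeff_funs K B) lincomb"
  have \<gamma>: "bij_betw \<gamma> UNIV (coeff_funs K B)"
    unfolding \<gamma>_def using B by (intro bij_betw_inv_into) (simp add: basis_over_def)
  have \<gamma>_mem: "\<gamma> x \<in> coeff_funs K B" for x using \<gamma> by (auto simp: bij_betw_def)
  have lin_\<gamma>: "lincomb (\<gamma> x) = x" for x
    unfolding \<gamma>_def using B by (simp add: basis_over_def bij_betw_def f_inv_into_f)
  have \<gamma>_eq: "\<gamma> x = c" if "c \<in> coeff_funs K B" "lincomb c = x" for x c
    unfolding \<gamma>_def using B that by (intro inv_into_f_eq) (auto simp: basis_over_def bij_betw_def)
  have \<gamma>_K: "\<gamma> x b \<in> K" for x b using \<gamma>_mem[of x] by (auto simp: coeff_funs_def)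
  define \<xi> where "\<xi> x = lincomb (\<Phi> (\<gamma> x))" for x
  show thesis
  proof
    have "bij_betw (lincomb \<circ> (\<Phi> \<circ> \<gamma>)) UNIV UNIV"
      using \<gamma> bij C unfolding basis_over_def by (intro bij_betw_trans)
    then show "bij \<xi>" by (simp add: \<xi>_def[abs_def] o_def)
  next
    fix x y
    have "\<gamma> (x + y) = (\<lambda>b. \<gamma> x b + \<gamma> y b)"
      using \<gamma>_mem[of x] \<gamma>_mem[of y]
      by (intro \<gamma>_eq K.coeff_funs_add) (simp_all add: lincomb_add lin_\<gamma> coeff_funs_def)
    then have "\<Phi> (\<gamma> (x + y)) = (\<lambda>b. \<Phi> (\<gamma> x) b + \<Phi> (\<gamma> y) b)"
      using \<gamma>_K by (auto simp: \<Phi>_def \<sigma>_add)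
    then show "\<xi> (x + y) = \<xi> x + \<xi> y"
      using \<Phi>_mem[OF \<gamma>_mem[of x]] \<Phi>_mem[OF \<gamma>_mem[of y]]
      by (simp add: \<xi>_def lincomb_add coeff_funs_def)
  next
    fix k x assume k: "k \<in> K"
    have "\<gamma> (k * x) = (\<lambda>b. k * \<gamma> x b)"
      using \<gamma>_mem[of x] k
      by (intro \<gamma>_eq K.coeff_funs_scale) (simp_all add: lincomb_scale lin_\<gamma> coeff_funs_def)
    then have "\<Phi> (\<gamma> (k * x)) = (\<lambda>b. \<sigma> k * \<Phi> (\<gamma> x) b)"
      using \<gamma>_K k by (auto simp: \<Phi>_def \<sigma>_mult)
    then show "\<xi> (k * x) = \<sigma> k * \<xi> x"
      using \<Phi>_mem[OF \<gamma>_mem[of x]] by (simp add: \<xi>_def lincomb_scale coeff_funs_def)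
  qed
qed

section \<open>Integer polynomials and simple extensions of the rationals\<close>

abbreviation ipoly :: "int poly \<Rightarrow> 'a::field_char_0 \<Rightarrow> 'a"
  where "ipoly p x \<equiv> poly (map_poly of_int p) x"

lemma ipoly_pCons: "ipoly (pCons a p) x = of_int a + x * ipoly p x"
  by (simp add: map_poly_pCons)

lemma ipoly_add: "ipoly (p + q) x = ipoly p x + ipoly q x"
proof -
  have "map_poly of_int (p + q) = map_poly of_int p + (map_poly of_int q :: 'a poly)"
    by (intro poly_eqI) (simp add: coeff_map_poly)
  then show ?thesis by simp
qed

lemma ipoly_smult: "ipoly (smult a p) x = of_int a * ipoly p x"
  by (subst map_poly_smult) simp_all

lemma ipoly_diff: "ipoly (p - q) x = ipoly p x - ipoly q x"
  using ipoly_add[of "p - q" q x] by simp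

lemma ipoly_mult: "ipoly (p * q) x = ipoly p x * ipoly q x"
  by (induction p) (simp_all add: ipoly_pCons ipoly_add ipoly_smult algebra_simps)

lemma ipoly_1: "ipoly 1 x = 1"
  by (simp add: map_poly_1)

lemma ipoly_monom: "ipoly (monom 1 n) x = x ^ n"
  by (simp add: map_poly_monom poly_monom)

definition rat_adjoin :: "'a::field_char_0 \<Rightarrow> 'a set"
  where "rat_adjoin x = {ipoly p x / ipoly q x | p q. ipoly q x \<noteq> 0}"

lemma rat_adjoinI: "ipoly q x \<noteq> 0 \<Longrightarrow> ipoly p x / ipoly q x \<in> rat_adjoin x"
  by (auto simp: rat_adjoin_def)

lemma rat_adjoinE:
  assumes "y \<in> rat_adjoin x"
  obtains p q where "ipoly q x \<noteq> 0" "y = ipoly p x / ipoly q x"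
  using assms by (auto simp: rat_adjoin_def)

lemma field_subset_rat_adjoin: "field_subset (rat_adjoin x)"
proof
  show "1 \<in> rat_adjoin x" using rat_adjoinI[of 1 x 1] by (simp add: ipoly_1)
next
  fix a b assume "a \<in> rat_adjoin x" "b \<in> rat_adjoin x"
  then obtain p q r s where *: "ipoly q x \<noteq> 0" "a = ipoly p x / ipoly q x"
      "ipoly s x \<noteq> 0" "b = ipoly r x / ipoly s x"
    by (metis rat_adjoinE)
  then show "a - b \<in> rat_adjoin x" "a * b \<in> rat_adjoin x"
    using rat_adjoinI[of "q * s" x "p * s - r * q"] rat_adjoinI[of "q * s" x "p * r"]
    by (simp_all add: ipoly_mult ipoly_diff diff_frac_eq)
next
  fix a assume "a \<in> rat_adjoin x"
  then obtain p q where *: "ipoly q x \<noteq> 0" "a = ipoly p x / ipoly q x" by (rule rat_adjoinE)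
  show "inverse a \<in> rat_adjoin x"
  proof (cases "ipoly p x = 0")
    case True
    then show ?thesis using * rat_adjoinI[of q x 0] by simp
  next
    case False
    then show ?thesis using * rat_adjoinI[of p x q] by simp
  qed
qed

lemma countable_rat_adjoin: "countable (rat_adjoin x)"
proof -
  have "inj_on coeffs (UNIV :: int poly set)"
    by (rule inj_onI) (metis Poly_coeffs)
  then have "countable (UNIV :: int poly set)"
    by (rule countable_image_inj_on[rotated]) simp
  then have "countable ((\<lambda>(p, q). ipoly p x / ipoly q x) ` (UNIV \<times> UNIV))"
    by (intro countable_image countable_SIGMA)
  then show ?thesis by (rule countable_subset[rotated]) (auto simp: rat_adjoin_def)
qed

lemma rat_adjoin_iso_exists:
  fixes x y :: "'a::field_char_0"
  assumes roots: "\<And>p. ipoly p x = 0 \<longleftrightarrow> ipoly p y = 0"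
  obtains \<sigma> where "bij_betw \<sigma> (rat_adjoin x) (rat_adjoin y)"
    "\<And>a b. \<lbrakk>a \<in> rat_adjoin x; b \<in> rat_adjoin x\<rbrakk> \<Longrightarrow> \<sigma> (a + b) = \<sigma> a + \<sigma> b"
    "\<And>a b. \<lbrakk>a \<in> rat_adjoin x; b \<in> rat_adjoin x\<rbrakk> \<Longrightarrow> \<sigma> (a * b) = \<sigma> a * \<sigma> b"
    "\<And>p q. ipoly q x \<noteq> 0 \<Longrightarrow> \<sigma> (ipoly p x / ipoly q x) = ipoly p y / ipoly q y"
proof -
  have frac_eq_iff: "ipoly p x / ipoly q x = ipoly r x / ipoly s x \<longleftrightarrow>
      ipoly p y / ipoly q y = ipoly r y / ipoly s y"
    if "ipoly q x \<noteq> 0" "ipoly s x \<noteq> 0" for p q r s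
    using that roots[of q] roots[of s] roots[of "p * s - r * q"]
    by (simp add: ipoly_mult ipoly_diff frac_eq_eq)
  define \<sigma> where "\<sigma> a = (SOME b. \<exists>p q. ipoly q x \<noteq> 0 \<and>
    a = ipoly p x / ipoly q x \<and> b = ipoly p y / ipoly q y)" for a
  have \<sigma>: "\<sigma> (ipoly p x / ipoly q x) = ipoly p y / ipoly q y" if q: "ipoly q x \<noteq> 0" for p q
    unfolding \<sigma>_def
  proof (rule some_equality)
    fix b assume "\<exists>p' q'. ipoly q' x \<noteq> 0 \<and> ipoly p x / ipoly q x = ipoly p' x / ipoly q' x \<and>
      b = ipoly p' y / ipoly q' y"
    then show "b = ipoly p y / ipoly q y" using frac_eq_iff[OF q] by metis
  qed (use q in blast)
  show thesis
  proof
    show "bij_betw \<sigma> (rat_adjoin x) (rat_adjoin y)"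
    proof (rule bij_betw_imageI)
      show "inj_on \<sigma> (rat_adjoin x)"
        by (rule inj_onI) (metis rat_adjoinE \<sigma> frac_eq_iff)
      have "\<sigma> ` rat_adjoin x \<subseteq> rat_adjoin y"
        by (metis (no_types, lifting) image_subsetI rat_adjoinE rat_adjoinI \<sigma> roots)
      moreover have "rat_adjoin y \<subseteq> \<sigma> ` rat_adjoin x"
        by (metis (no_types, lifting) subsetI imageI rat_adjoinE rat_adjoinI \<sigma> roots)
      ultimately show "\<sigma> ` rat_adjoin x = rat_adjoin y" by blast
    qed
  next
    fix a b assume "a \<in> rat_adjoin x" "b \<in> rat_adjoin x"
    then obtain p q r s where *: "ipoly q x \<noteq> 0" "a = ipoly p x / ipoly q x"
        "ipoly s x \<noteq> 0" "b = ipoly r x / ipoly s x"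
      by (metis rat_adjoinE)
    then have "ipoly q y \<noteq> 0" "ipoly s y \<noteq> 0" by (simp_all add: roots)
    then show "\<sigma> (a + b) = \<sigma> a + \<sigma> b" "\<sigma> (a * b) = \<sigma> a * \<sigma> b"
      using * \<sigma>[of "q * s" "p * s + r * q"] \<sigma>[of "q * s" "p * r"] \<sigma>[of q p] \<sigma>[of s r]
      by (simp_all add: ipoly_mult ipoly_add add_frac_eq)
  qed (rule \<sigma>)
qed

section \<open>Additive conjugacy\<close>

lemma additive_of_int_mult:
  fixes \<xi> :: "'a::ring_1 \<Rightarrow> 'b::ring_1"
  assumes "Modules.additive \<xi>"
  shows "\<xi> (of_int n * x) = of_int n * \<xi> x"
proof -
  interpret Modules.additive \<xi> by fact
  show ?thesis
    by (induction n rule: int_induct[of _ 0]) (simp_all add: zero add diff algebra_simps)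
qed

lemma additive_ipoly_mult:
  assumes "Modules.additive \<xi>" and "\<And>x. \<xi> (z * x) = w * \<xi> x"
  shows "\<xi> (ipoly p z * x) = ipoly p w * \<xi> x"
proof -
  interpret Modules.additive \<xi> by fact
  show ?thesis
    by (induction p)
      (simp_all add: zero add ipoly_pCons distrib_right additive_of_int_mult[OF assms(1)]
        assms(2) mult.assoc)
qed

lemma additive_conjugate_imp_same_roots:
  assumes "additive_conjugate integer_group (int_rep z) (int_rep w)"
  shows "ipoly p z = 0 \<longleftrightarrow> ipoly p w = 0"
proof -
  obtain \<xi> where \<xi>: "bij \<xi>" "\<And>x y. \<xi> (x + y) = \<xi> x + \<xi> y"
      "\<And>n x. \<xi> (int_rep z n x) = int_rep w n (\<xi> x)"
    using assms by (auto simp: additive_conjugate_def)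
  have add: "Modules.additive \<xi>" by standard (rule \<xi>)
  have zw: "\<xi> (z * x) = w * \<xi> x" for x using \<xi>(3)[of 1 x] by (simp add: int_rep_def)
  have \<xi>0: "\<xi> 0 = 0" using add by (rule Modules.additive.zero)
  then have "\<xi> 1 \<noteq> 0" using \<xi>(1) by (metis bij_is_inj injD zero_neq_one)
  moreover have "\<xi> (ipoly p z) = ipoly p w * \<xi> 1"
    using additive_ipoly_mult[OF add zw, of p 1] by simp
  ultimately show ?thesis using \<xi>0 \<xi>(1) by (metis bij_is_inj injD mult_eq_0_iff)
qed

lemma same_roots_imp_additive_conjugate:
  assumes z: "z \<noteq> 0" and roots: "\<And>p. ipoly p z = 0 \<longleftrightarrow> ipoly p w = 0"
  shows "additive_conjugate integer_group (int_rep z) (int_rep w)"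
proof -
  obtain \<sigma> where \<sigma>: "bij_betw \<sigma> (rat_adjoin z) (rat_adjoin w)"
      "\<And>a b. \<lbrakk>a \<in> rat_adjoin z; b \<in> rat_adjoin z\<rbrakk> \<Longrightarrow> \<sigma> (a + b) = \<sigma> a + \<sigma> b"
      "\<And>a b. \<lbrakk>a \<in> rat_adjoin z; b \<in> rat_adjoin z\<rbrakk> \<Longrightarrow> \<sigma> (a * b) = \<sigma> a * \<sigma> b"
      "\<And>p q. ipoly q z \<noteq> 0 \<Longrightarrow> \<sigma> (ipoly p z / ipoly q z) = ipoly p w / ipoly q w"
    using rat_adjoin_iso_exists[of z w] roots by metis
  obtain \<xi> where \<xi>: "bij \<xi>" "\<And>x y. \<xi> (x + y) = \<xi> x + \<xi> y"
      "\<And>k x. k \<in> rat_adjoin z \<Longrightarrow> \<xi> (k * x) = \<sigma> k * \<xi> x"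
    using semilinear_bij_exists[OF field_subset_rat_adjoin field_subset_rat_adjoin \<sigma>(1-3)
        countable_rat_adjoin uncountable_UNIV_complex] by metis
  have powi: "z powi n \<in> rat_adjoin z \<and> \<sigma> (z powi n) = w powi n" for n
  proof (cases "n \<ge> 0")
    case True
    then show ?thesis
      using rat_adjoinI[of 1 z "monom 1 (nat n)"] \<sigma>(4)[of 1 "monom 1 (nat n)"]
      by (simp add: ipoly_1 ipoly_monom power_int_def)
  next
    case False
    then show ?thesis
      using z rat_adjoinI[of "monom 1 (nat (- n))" z 1] \<sigma>(4)[of "monom 1 (nat (- n))" 1]
      by (simp add: ipoly_1 ipoly_monom power_int_def inverse_eq_divide power_one_over)
  qed
  then have "\<xi> (int_rep z n x) = int_rep w n (\<xi> x)" for n x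
    using \<xi>(3) by (simp add: int_rep_def)
  then show ?thesis using \<xi>(1,2) by (auto simp: additive_conjugate_def)
qed

theorem theorem17:
  fixes z w :: complex
  assumes "norm z = 1" and "norm w = 1"
  shows "additive_conjugate integer_group (int_rep z) (int_rep w) \<longleftrightarrow>
    (\<forall>p :: int poly. poly (map_poly of_int p) z = 0 \<longleftrightarrow> poly (map_poly of_int p) w = 0)"
proof -
  have "z \<noteq> 0" using assms(1) by auto
  then show ?thesis
    using additive_conjugate_imp_same_roots same_roots_imp_additive_conjugate by blast
qed

end
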